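(* Let $\alpha\in\mathbb{N}_0$, $\beta>-1$ and $N>0$. The polynomials $y_n(x)=P_n^{\alpha,\beta,0,N}(x)$, $n\in\mathbb{N}_0$, which are the polynomial eigensolutions of the equation $$N\big\{L_{2\alpha+4,x}^{\alpha,\beta}-\Lambda_{2\alpha+4,n}^{\alpha,\beta}\big\}y(x)+C_{\alpha,\beta}\big\{L_{2,x}^{\alpha,\beta}-\Lambda_{2,n}^{\alpha,\beta}\big\}y(x)=0,\qquad -1<x<1,$$ satisfy, for $n\ne m$, the orthogonality relation $$(y_n,y_m)_{w(\alpha,\beta,0,N)}=\int_{-1}^{1}y_n(x)y_m(x)\,w_{\alpha,\beta}(x)\,dx+N y_n(1)y_m(1)=0.$$
   Context: $\mathbb{N}=\{1,2,\dots\}$, $\mathbb{N}_0=\{0,1,2,\dots\}$; $(a)_k=a(a+1)\cdots(a+k-1)$, $(a)_0=1$; $D_x^i$ is $i$-fold differentiation with respect to $x$. The classical Jacobi polynomials are $P_n^{\alpha,\beta}(x)=\frac{(\alpha+1)_n}{n!}\,{}_2F_1\big(-n,n+\alpha+\beta+1;\alpha+1;\frac{1-x}{2}\big)$. The Jacobi-type polynomials are $P_n^{\alpha,\beta,0,N}(x)=P_n^{\alpha,\beta}(x)+N R_n^{\alpha,\beta}(x)$, where $R_0^{\alpha,\beta}(x)=0$ and, for $n\in\mathbb{N}$, $R_n^{\alpha,\beta}(x)=A_n^{\alpha,\beta}(x-1)P_{n-1}^{\alpha+2,\beta}(x)$ with $A_n^{\alpha,\beta}=\dfrac{(\alpha+2)_{n-1}(\alpha+\beta+2)_n}{2\,n!\,(\beta+1)_{n-1}}$.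 Weight: $w_{\alpha,\beta}(x)=h_{\alpha,\beta}^{-1}(1-x)^{\alpha}(1+x)^{\beta}$ with $h_{\alpha,\beta}=\int_{-1}^1(1-x)^\alpha(1+x)^\beta dx=2^{\alpha+\beta+1}\Gamma(\alpha+1)\Gamma(\beta+1)/\Gamma(\alpha+\beta+2)$. Operators and constants: $$L_{2\alpha+4,x}^{\alpha,\beta}y(x)=\frac{x-1}{(x+1)^{\beta}}D_x^{\alpha+2}\Big\{(x+1)^{\alpha+\beta+2}D_x^{\alpha+2}\big[(x-1)^{\alpha+1}y(x)\big]\Big\},$$ $$L_{2,x}^{\alpha,\beta}y(x)=\big\{(x^2-1)D_x^2+[\alpha-\beta+(\alpha+\beta+2)x]D_x\big\}y(x),$$ $\Lambda_{2\alpha+4,n}^{\alpha,\beta}=(n)_{\alpha+2}(n+\beta)_{\alpha+2}$, $\Lambda_{2,n}^{\alpha,\beta}=n(n+\alpha+\beta+1)$, $C_{\alpha,\beta}=(\alpha+2)!\,(\beta+1)_{\alpha+1}$. *)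

theory Defs
  imports "HOL-Analysis.Analysis"
begin

definition gauss_2F1 :: "real \<Rightarrow> real \<Rightarrow> real \<Rightarrow> real \<Rightarrow> real" where
  "gauss_2F1 a b c z = eval_fps (fps_hypergeo [a, b] [c] 1) z"

definition jacobi_P :: "real \<Rightarrow> real \<Rightarrow> nat \<Rightarrow> real \<Rightarrow> real" where
  "jacobi_P \<alpha> \<beta> n x =
     pochhammer (\<alpha> + 1) n / fact n
       * gauss_2F1 (- real n) (real n + \<alpha> + \<beta> + 1) (\<alpha> + 1) ((1 - x) / 2)"

definition jacobi_A :: "real \<Rightarrow> real \<Rightarrow> nat \<Rightarrow> real" where
  "jacobi_A \<alpha> \<beta> n =
     pochhammer (\<alpha> + 2) (n - 1) * pochhammer (\<alpha> + \<beta> + 2) n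
       / (2 * fact n * pochhammer (\<beta> + 1) (n - 1))"

definition jacobi_R :: "real \<Rightarrow> real \<Rightarrow> nat \<Rightarrow> real \<Rightarrow> real" where
  "jacobi_R \<alpha> \<beta> n x =
     (if n = 0 then 0 else jacobi_A \<alpha> \<beta> n * (x - 1) * jacobi_P (\<alpha> + 2) \<beta> (n - 1) x)"

definition jacobi_type :: "real \<Rightarrow> real \<Rightarrow> real \<Rightarrow> nat \<Rightarrow> real \<Rightarrow> real" where
  "jacobi_type \<alpha> \<beta> N n x = jacobi_P \<alpha> \<beta> n x + N * jacobi_R \<alpha> \<beta> n x"

text \<open>For \<open>\<alpha>, \<beta> > -1\<close> the normalisation constant is
  \<open>2 powr (\<alpha> + \<beta> + 1) * Gamma (\<alpha> + 1) * Gamma (\<beta> + 1) / Gamma (\<alpha> + \<beta> + 2)\<close>.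
  Since \<open>0 powr a = 0\<close>, the values at the end points \<open>-1\<close> and \<open>1\<close> can differ from the customary
  ones; this does not affect the integrals.\<close>

definition jacobi_h :: "real \<Rightarrow> real \<Rightarrow> real" where
  "jacobi_h \<alpha> \<beta> = integral {-1..1} (\<lambda>x. (1 - x) powr \<alpha> * (1 + x) powr \<beta>)"

definition jacobi_w :: "real \<Rightarrow> real \<Rightarrow> real \<Rightarrow> real" where
  "jacobi_w \<alpha> \<beta> x = inverse (jacobi_h \<alpha> \<beta>) * (1 - x) powr \<alpha> * (1 + x) powr \<beta>"

definition jacobi_type_inner ::
    "real \<Rightarrow> real \<Rightarrow> real \<Rightarrow> (real \<Rightarrow> real) \<Rightarrow> (real \<Rightarrow> real) \<Rightarrow> real" where
  "jacobi_type_inner \<alpha> \<beta> N f g =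
     integral {-1..1} (\<lambda>x. f x * g x * jacobi_w \<alpha> \<beta> x) + N * f 1 * g 1"

text \<open>The operators below are meant for arguments in the open interval from \<open>-1\<close> to \<open>1\<close>,
  where the base of the real powers is positive.\<close>

definition L_high :: "nat \<Rightarrow> real \<Rightarrow> (real \<Rightarrow> real) \<Rightarrow> real \<Rightarrow> real" where
  "L_high \<alpha> \<beta> y x =
     (x - 1) / (x + 1) powr \<beta>
       * (deriv ^^ (\<alpha> + 2))
           (\<lambda>t. (t + 1) powr (real \<alpha> + \<beta> + 2)
                * (deriv ^^ (\<alpha> + 2)) (\<lambda>s. (s - 1) ^ (\<alpha> + 1) * y s) t) x"

definition L_two :: "real \<Rightarrow> real \<Rightarrow> (real \<Rightarrow> real) \<Rightarrow> real \<Rightarrow> real" where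
  "L_two \<alpha> \<beta> y x =
     (x\<^sup>2 - 1) * (deriv ^^ 2) y x + (\<alpha> - \<beta> + (\<alpha> + \<beta> + 2) * x) * deriv y x"

definition Lambda_high :: "nat \<Rightarrow> real \<Rightarrow> nat \<Rightarrow> real" where
  "Lambda_high \<alpha> \<beta> n = pochhammer (real n) (\<alpha> + 2) * pochhammer (real n + \<beta>) (\<alpha> + 2)"

definition Lambda_two :: "real \<Rightarrow> real \<Rightarrow> nat \<Rightarrow> real" where
  "Lambda_two \<alpha> \<beta> n = real n * (real n + \<alpha> + \<beta> + 1)"

definition C_const :: "nat \<Rightarrow> real \<Rightarrow> real" where
  "C_const \<alpha> \<beta> = fact (\<alpha> + 2) * pochhammer (\<beta> + 1) (\<alpha> + 1)"

definition solves_jacobi_type_eq :: "nat \<Rightarrow> real \<Rightarrow> real \<Rightarrow> nat \<Rightarrow> (real \<Rightarrow> real) \<Rightarrow> bool" where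
  "solves_jacobi_type_eq \<alpha> \<beta> N n y \<longleftrightarrow>
     (\<forall>x\<in>{-1<..<1}.
        N * (L_high \<alpha> \<beta> y x - Lambda_high \<alpha> \<beta> n * y x)
        + C_const \<alpha> \<beta> * (L_two (real \<alpha>) \<beta> y x - Lambda_two (real \<alpha>) \<beta> n * y x) = 0)"

end

theory Submission
  imports Defs
begin

text \<open>
  On polynomials, the differential equation is the eigenvalue equation of an operator
  \<open>jacobi_type_op\<close> that is upper triangular with respect to the powers of \<open>x\<close>, with strictly
  increasing diagonal entries \<open>jacobi_type_eigenvalue\<close>. So there is at most one
  eigenpolynomial for each \<open>n\<close>, up to a factor, and it has degree \<open>n\<close>.

  That the Jacobi-type polynomials are the eigenpolynomials is not verified by computation.
  Instead they are characterised by orthogonality, in the following way.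

  The first ingredient is \<open>jacobi_type_poly_orthogonal\<close>: the \<open>n\<close>-th polynomial is orthogonal
  to every polynomial of smaller degree. In the variables \<open>u = (1 - x) / 2\<close> and
  \<open>v = (1 + x) / 2\<close> all moments of the weight are quotients of Pochhammer symbols, and for
  suitable test polynomials the sums that arise are instances of the Chu--Vandermonde
  identity. The constant in the definition of the second summand makes its integral cancel
  the point mass of the first.

  The second ingredient is \<open>jacobi_type_op_symmetric\<close>: the operator is symmetric for the
  bilinear form with the point mass. The operator of high order is composed of factors that
  are, up to a shift of the exponent, diagonal on powers of \<open>u\<close> and on powers of \<open>v\<close>,
  respectively, so that its matrix entries are again explicit moments. It is symmetric for
  the weight up to a boundary term at \<open>x = 1\<close>, and the constant in front of the operator of
  second order makes the point mass cancel precisely this term.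

  If \<open>y\<close> is the \<open>n\<close>-th polynomial, then the operator applied to \<open>y\<close>, minus the eigenvalue
  times \<open>y\<close>, has degree less than \<open>n\<close> and is orthogonal to all polynomials of degree less
  than \<open>n\<close>. As the form is positive definite, this difference is zero
  (\<open>jacobi_type_poly_eigen\<close>).
\<close>

section \<open>Polynomials in two affine variables\<close>

text \<open>
  The weight is a product of powers of \<open>u = (1 - x) / 2\<close> and \<open>v = (1 + x) / 2\<close>. Each of the
  two factors of the operator of high order is diagonal, up to a shift of the exponent, on
  the powers of one of these variables, so both are needed as polynomials in \<open>x\<close>.
\<close>
definition pu :: "real poly" where "pu = [:1/2, -1/2:]"
definition pv :: "real poly" where "pv = [:1/2, 1/2:]"

lemma poly_pu: "poly pu x = (1 - x) / 2" and poly_pv: "poly pv x = (1 + x) / 2"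
  by (simp_all add: pu_def pv_def field_simps)

lemma pu_add_pv: "pu + pv = 1"
  by (simp add: pu_def pv_def)

lemma pderiv_pu: "pderiv pu = [:-1/2:]" and pderiv_pv: "pderiv pv = [:1/2:]"
  by (simp_all add: pu_def pv_def pderiv_pCons)

lemma poly_eq_sum_linear_powers:
  fixes p :: "'a::field poly"
  assumes "b \<noteq> 0"
  obtains q where "p = (\<Sum>i\<le>degree p. smult (coeff q i) ([:a, b:] ^ i))"
proof -
  \<comment> \<open>The coefficients are those of \<open>p\<close> as a polynomial in the new variable \<open>a + b x\<close>.\<close>
  define q where "q = pcompose p [:-a/b, 1/b:]"
  have dq: "degree q = degree p" using assms by (simp add: q_def degree_pcompose)
  have "pcompose q [:a, b:] = p"
    unfolding q_def pcompose_assoc[symmetric] using assms by (simp add: pcompose_pCons)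
  moreover have "pcompose q [:a, b:] = (\<Sum>i\<le>degree p. pcompose (monom (coeff q i) i) [:a, b:])"
    by (subst (1) poly_as_sum_of_monoms[symmetric]) (simp only: pcompose_sum dq)
  moreover have "pcompose (monom c i) [:a, b:] = smult c ([:a, b:] ^ i)" for c :: 'a and i
    by (induction i) (simp_all add: monom_0 monom_Suc pcompose_pCons)
  ultimately have "p = (\<Sum>i\<le>degree p. smult (coeff q i) ([:a, b:] ^ i))" by simp
  thus ?thesis by (rule that)
qed

text \<open>
  All linear identities below are checked on the powers of \<open>u\<close> or of \<open>v\<close>, whichever makes
  the operator at hand diagonal. The degree bound is what orthogonality to polynomials of
  smaller degree requires.
\<close>
lemma poly_induct_linear_powers [consumes 2, case_names zero add power]:
  fixes p :: "'a::field poly"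
  assumes "b \<noteq> 0" "degree p \<le> n"
    and zero: "P 0" and add: "\<And>p q. P p \<Longrightarrow> P q \<Longrightarrow> P (p + q)"
    and power: "\<And>c i. i \<le> n \<Longrightarrow> P (smult c ([:a, b:] ^ i))"
  shows "P p"
proof -
  obtain q where q: "p = (\<Sum>i\<le>degree p. smult (coeff q i) ([:a, b:] ^ i))"
    using poly_eq_sum_linear_powers[OF \<open>b \<noteq> 0\<close>] by blast
  have "P (\<Sum>i\<in>A. smult (coeff q i) ([:a, b:] ^ i))" if "A \<subseteq> {..n}" for A
    using finite_subset[OF that finite_atMost] that
    by (induction rule: finite_induct) (auto intro!: zero add power)
  thus ?thesis using q assms(2) by (metis atMost_subset_iff)
qed

section \<open>The differential operators on polynomials\<close>

text \<open>
  This is \<open>(x + 1)\<close> to the power \<open>- b\<close>, times the \<open>k\<close>-th derivative of \<open>(x + 1)\<close> to the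
  power \<open>b + k\<close> times \<open>q\<close>. The recursion performs the innermost differentiation, after which
  \<open>(x + 1)\<close> to the power \<open>b + k\<close> can be factored out of what remains; thus the operator is
  defined without real powers and visibly maps polynomials to polynomials.
\<close>
primrec euler_op :: "real \<Rightarrow> nat \<Rightarrow> real poly \<Rightarrow> real poly" where
  "euler_op b 0 q = q"
| "euler_op b (Suc k) q = euler_op b k (smult (b + real (Suc k)) q + [:1, 1:] * pderiv q)"

lemma euler_op_add: "euler_op b k (p + q) = euler_op b k p + euler_op b k q"
proof (induction k arbitrary: p q)
  case (Suc k)
  have "smult (b + real (Suc k)) (p + q) + [:1, 1:] * pderiv (p + q)
      = (smult (b + real (Suc k)) p + [:1, 1:] * pderiv p)
        + (smult (b + real (Suc k)) q + [:1, 1:] * pderiv q)"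
    by (simp only: pderiv_add smult_add_right distrib_left add_ac)
  thus ?case by (simp only: euler_op.simps Suc)
qed simp

lemma euler_op_smult: "euler_op b k (smult c p) = smult c (euler_op b k p)"
proof (induction k arbitrary: p)
  case (Suc k)
  have "smult (b + real (Suc k)) (smult c p) + [:1, 1:] * pderiv (smult c p)
      = smult c (smult (b + real (Suc k)) p + [:1, 1:] * pderiv p)"
    by (simp add: pderiv_smult smult_add_right mult.commute)
  thus ?case by (simp only: euler_op.simps Suc)
qed simp

lemma euler_op_0 [simp]: "euler_op b k 0 = 0"
  using euler_op_smult[of b k 0 0] by simp

text \<open>
  The operator is a polynomial in the Euler operator \<open>v d/dv\<close>, hence diagonal on powers of
  \<open>v\<close>.
\<close>
lemma euler_op_pv_power: "euler_op b k (pv ^ j) = smult (pochhammer (b + 1 + real j) k) (pv ^ j)"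
proof (induction k)
  case (Suc k)
  have "[:1, 1:] = smult 2 pv" by (simp add: pv_def)
  hence "[:1, 1:] * pderiv (pv ^ j) = smult (real j) (pv ^ j)"
    by (cases j) (simp_all add: pderiv_power_Suc pderiv_pv mult_ac del: power_Suc, simp add: mult_ac add_divide_distrib)
  hence "euler_op b (Suc k) (pv ^ j) = euler_op b k (smult (b + real (Suc k) + real j) (pv ^ j))"
    by (simp add: smult_add_left)
  thus ?case by (simp add: euler_op_smult Suc pochhammer_Suc algebra_simps)
qed simp

text \<open>
  The eigenvalue on the \<open>n\<close>-th power of \<open>v\<close> is also the factor by which the coefficient of
  \<open>x\<close> to the \<open>n\<close> is multiplied, since the operator does not raise degrees.
\<close>
lemma euler_op_leading:
  assumes "degree q \<le> n"
  shows "degree (euler_op b k q) \<le> n \<and>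
         coeff (euler_op b k q) n = pochhammer (b + 1 + real n) k * coeff q n"
  using assms
proof (induction k arbitrary: q)
  case (Suc k)
  let ?q = "smult (b + real (Suc k)) q + [:1, 1:] * pderiv q"
  have "coeff q i = 0" if "i > n" for i using Suc.prems that by (simp add: coeff_eq_0)
  hence c: "coeff ?q i = (b + real (Suc k) + real i) * coeff q i" if "i \<ge> n" for i
    using that by (cases i) (simp_all add: coeff_pderiv algebra_simps)
  have "degree ?q \<le> n"
    using \<open>\<And>i. i > n \<Longrightarrow> coeff q i = 0\<close> by (intro degree_le allI impI) (subst c, auto)
  from Suc.IH[OF this] c[of n] show ?case
    by (simp only: euler_op.simps) (simp add: pochhammer_Suc algebra_simps)
qed simp

text \<open>
  The equation for \<open>f\<close> is only available to the right of \<open>-1\<close>, where the base of the power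
  is positive; as this set is open, the equation may be differentiated there.
\<close>
lemma higher_deriv_powr_mult_poly:
  assumes "\<And>t. t > -1 \<Longrightarrow> f t = (t + 1) powr (b + real k) * poly q t" "t > -1"
  shows "(deriv ^^ k) f t = (t + 1) powr b * poly (euler_op b k q) t"
  using assms
proof (induction k arbitrary: f q t)
  case (Suc k)
  let ?q = "smult (b + real (Suc k)) q + [:1, 1:] * pderiv q"
  have "deriv f t = (t + 1) powr (b + real k) * poly ?q t" if "t > -1" for t
  proof -
    \<comment> \<open>Both terms of the product rule contain the power with exponent \<open>b + k\<close>.\<close>
    have pw: "(t + 1) powr (b + real (Suc k)) = (t + 1) powr (b + real k) * (t + 1)"
      using that powr_add[of "t + 1" "b + real k" 1] by (simp add: add_ac)
    have "((\<lambda>t. (t + 1) powr (b + real (Suc k))) has_real_derivative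
             (b + real (Suc k)) * (t + 1) powr (b + real k)) (at t)"
      using DERIV_fun_powr[of "\<lambda>t. t + 1" 1 t "b + real (Suc k)"] that
      by (auto intro!: derivative_eq_intros)
    from DERIV_mult[OF this poly_DERIV[of q]]
    have "((\<lambda>t. (t + 1) powr (b + real (Suc k)) * poly q t) has_real_derivative
             (t + 1) powr (b + real k) * poly ?q t) (at t)"
      unfolding pw by (simp add: algebra_simps)
    moreover have "\<forall>\<^sub>F s in nhds t. s \<in> {-1<..}"
      using that by (intro eventually_nhds_in_open) auto
    hence "\<forall>\<^sub>F s in nhds t. f s = (s + 1) powr (b + real (Suc k)) * poly q s"
      by eventually_elim (use Suc.prems(1) in auto)
    ultimately have "(f has_real_derivative (t + 1) powr (b + real k) * poly ?q t) (at t)"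
      using DERIV_cong_ev[OF refl _ refl] by fast
    thus ?thesis by (rule DERIV_imp_deriv)
  qed
  from Suc.IH[OF this Suc.prems(2)] show ?case
    by (simp add: funpow_Suc_right del: funpow.simps)
qed simp

lemma higher_deriv_poly: "(deriv ^^ k) (poly p) = poly ((pderiv ^^ k) p)" for p :: "real poly"
  by (induction k) (auto intro!: ext DERIV_imp_deriv)

definition high_op :: "nat \<Rightarrow> real \<Rightarrow> real poly \<Rightarrow> real poly" where
  "high_op \<alpha> \<beta> p =
     [:-1, 1:] * euler_op \<beta> (\<alpha> + 2) ((pderiv ^^ (\<alpha> + 2)) ([:-1, 1:] ^ (\<alpha> + 1) * p))"

lemma L_high_poly:
  assumes "x \<in> {-1<..<1}"
  shows "L_high \<alpha> \<beta> (poly p) x = poly (high_op \<alpha> \<beta> p) x"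
proof -
  have "(\<lambda>s. (s - 1) ^ (\<alpha> + 1) * poly p s) = poly ([:-1, 1:] ^ (\<alpha> + 1) * p)"
    by (simp add: fun_eq_iff poly_power left_diff_distrib)
  moreover have "(deriv ^^ (\<alpha> + 2)) (\<lambda>t. (t + 1) powr (real \<alpha> + \<beta> + 2) * poly r t) x
      = (x + 1) powr \<beta> * poly (euler_op \<beta> (\<alpha> + 2) r) x" for r
    using assms by (intro higher_deriv_powr_mult_poly) (simp_all add: algebra_simps)
  moreover have "(x + 1) powr \<beta> \<noteq> 0" using assms by simp
  moreover have "poly ([:-1, 1:] * r) x = (x - 1) * poly r x" for r
    by (simp add: left_diff_distrib)
  ultimately show ?thesis unfolding L_high_def high_op_def by (simp only: higher_deriv_poly) simp
qed

definition two_op :: "real \<Rightarrow> real \<Rightarrow> real poly \<Rightarrow> real poly" where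
  "two_op \<alpha> \<beta> p = [:-1, 0, 1:] * pderiv (pderiv p) + [:\<alpha> - \<beta>, \<alpha> + \<beta> + 2:] * pderiv p"

lemma L_two_poly: "L_two \<alpha> \<beta> (poly p) x = poly (two_op \<alpha> \<beta> p) x"
  using higher_deriv_poly[of 1 p] higher_deriv_poly[of 1 "pderiv p"]
  by (simp add: L_two_def two_op_def higher_deriv_poly numeral_2_eq_2 algebra_simps power2_eq_square)

definition jacobi_type_op :: "nat \<Rightarrow> real \<Rightarrow> real \<Rightarrow> real poly \<Rightarrow> real poly" where
  "jacobi_type_op \<alpha> \<beta> N p =
     smult N (high_op \<alpha> \<beta> p) + smult (C_const \<alpha> \<beta>) (two_op (real \<alpha>) \<beta> p)"

definition jacobi_type_eigenvalue :: "nat \<Rightarrow> real \<Rightarrow> real \<Rightarrow> nat \<Rightarrow> real" where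
  "jacobi_type_eigenvalue \<alpha> \<beta> N n = N * Lambda_high \<alpha> \<beta> n + C_const \<alpha> \<beta> * Lambda_two (real \<alpha>) \<beta> n"

text \<open>
  Both sides of the differential equation are polynomials, so their equality on an interval
  is an identity of polynomials and the equation becomes an eigenvalue problem of linear
  algebra.
\<close>
lemma solves_jacobi_type_eq_iff:
  "solves_jacobi_type_eq \<alpha> \<beta> N n (poly p) \<longleftrightarrow> jacobi_type_op \<alpha> \<beta> N p = smult (jacobi_type_eigenvalue \<alpha> \<beta> N n) p"
proof -
  let ?d = "jacobi_type_op \<alpha> \<beta> N p - smult (jacobi_type_eigenvalue \<alpha> \<beta> N n) p"
  have "solves_jacobi_type_eq \<alpha> \<beta> N n (poly p) \<longleftrightarrow> (\<forall>x\<in>{-1<..<1}. poly ?d x = 0)"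
    by (auto simp: solves_jacobi_type_eq_def L_high_poly L_two_poly jacobi_type_op_def jacobi_type_eigenvalue_def algebra_simps)
  also have "\<dots> \<longleftrightarrow> ?d = 0"
  proof
    assume "\<forall>x\<in>{-1<..<1}. poly ?d x = 0"
    hence "{-1<..<1} \<subseteq> {x. poly ?d x = 0}" by blast
    moreover have "infinite {-1<..<(1::real)}" by simp
    ultimately show "?d = 0" using poly_roots_finite[of ?d] finite_subset by blast
  qed simp
  finally show ?thesis by simp
qed

section \<open>Eigenvalues\<close>

lemma linear_power_mult_leading:
  fixes p :: "'a::comm_ring_1 poly"
  assumes "degree p \<le> n"
  shows "degree ([:c, 1:] ^ m * p) \<le> n + m \<and> coeff ([:c, 1:] ^ m * p) (n + m) = coeff p n"
proof (induction m)
  case (Suc m)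
  let ?q = "[:c, 1:] ^ m * p"
  have e: "[:c, 1:] ^ Suc m * p = [:c, 1:] * ?q" by (simp only: power_Suc mult.assoc)
  have "degree ([:c, 1:] * ?q) \<le> n + Suc m"
    using Suc degree_mult_le[of "[:c, 1:]" ?q] by simp
  moreover have "coeff ?q (Suc (n + m)) = 0" using Suc by (intro coeff_eq_0) simp
  ultimately show ?case using Suc unfolding e by simp
qed (use assms in simp)

text \<open>
  The two differentiations contribute \<open>pochhammer n (\<alpha> + 2)\<close> and
  \<open>pochhammer (n + \<beta>) (\<alpha> + 2)\<close>. Between them the degree has dropped to \<open>n - 1\<close>,
  and the factor \<open>x - 1\<close> restores it; the case \<open>n = 0\<close> is separate because there the inner
  derivative vanishes.
\<close>
lemma high_op_leading:
  assumes "degree p \<le> n"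
  shows "degree (high_op \<alpha> \<beta> p) \<le> n \<and>
         coeff (high_op \<alpha> \<beta> p) n = Lambda_high \<alpha> \<beta> n * coeff p n"
proof -
  let ?r = "[:-1, 1:] ^ (\<alpha> + 1) * p"
  let ?q = "(pderiv ^^ (\<alpha> + 2)) ?r"
  have r: "degree ?r \<le> n + (\<alpha> + 1)" "coeff ?r (n + (\<alpha> + 1)) = coeff p n"
    using linear_power_mult_leading[OF assms] by blast+
  show ?thesis
  proof (cases n)
    case 0
    have "?q = 0"
      using r 0 by (intro poly_eqI) (simp add: coeff_higher_pderiv coeff_eq_0 del: funpow.simps)
    thus ?thesis using 0 by (simp add: high_op_def Lambda_high_def pochhammer_0_left del: funpow.simps)
  next
    case (Suc m)
    have "degree ?q \<le> m" using r Suc by (simp add: degree_higher_pderiv del: funpow.simps)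
    moreover have "coeff ?q m = pochhammer (real n) (\<alpha> + 2) * coeff p n"
      using r Suc by (simp add: coeff_higher_pderiv add.commute del: funpow.simps)
    ultimately have "degree (euler_op \<beta> (\<alpha> + 2) ?q) \<le> m"
      "coeff (euler_op \<beta> (\<alpha> + 2) ?q) m = Lambda_high \<alpha> \<beta> n * coeff p n"
      using euler_op_leading[of ?q m \<beta> "\<alpha> + 2"] Suc
      by (auto simp: Lambda_high_def algebra_simps simp del: funpow.simps euler_op.simps)
    thus ?thesis
      using linear_power_mult_leading[of "euler_op \<beta> (\<alpha> + 2) ?q" m "-1" 1] Suc
      unfolding high_op_def by simp
  qed
qed

lemma two_op_leading:
  assumes "degree p \<le> n"
  shows "degree (two_op \<alpha> \<beta> p) \<le> n \<and> coeff (two_op \<alpha> \<beta> p) n = Lambda_two \<alpha> \<beta> n * coeff p n"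
proof -
  have z: "coeff p i = 0" if "i > n" for i using assms that by (simp add: coeff_eq_0)
  have "coeff (two_op \<alpha> \<beta> p) i = Lambda_two \<alpha> \<beta> i * coeff p i" if "i \<ge> n" for i
  proof -
    have "coeff p (Suc i) = 0" "coeff p (Suc (Suc i)) = 0" using z that by auto
    thus ?thesis
      by (cases i; cases "i - 1")
         (simp_all add: two_op_def Lambda_two_def coeff_pderiv algebra_simps)
  qed
  thus ?thesis using z by (auto intro!: degree_le)
qed

text \<open>
  The operator is upper triangular with respect to the powers of \<open>x\<close>, and the eigenvalues
  are its diagonal entries.
\<close>
lemma jacobi_type_op_leading:
  assumes "degree p \<le> n"
  shows "degree (jacobi_type_op \<alpha> \<beta> N p) \<le> n \<and>
         coeff (jacobi_type_op \<alpha> \<beta> N p) n = jacobi_type_eigenvalue \<alpha> \<beta> N n * coeff p n"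
  using high_op_leading[OF assms] two_op_leading[OF assms]
  by (auto simp: jacobi_type_op_def jacobi_type_eigenvalue_def algebra_simps intro!: degree_add_le order.trans[OF degree_smult_le])

lemma pochhammer_real_strict_mono:
  "pochhammer x (Suc k) < pochhammer y (Suc k)" if "0 \<le> x" "x < (y::real)"
proof (induction k)
  case (Suc k)
  show ?case unfolding pochhammer_Suc[of _ "Suc k"]
    using Suc that by (intro mult_strict_mono) (auto intro!: pochhammer_nonneg pochhammer_pos simp del: pochhammer_Suc)
qed (use that in simp)

text \<open>
  Strictness comes from the operator of second order. The case \<open>m = 0\<close> is separate because
  \<open>m + \<beta>\<close> may then be negative; but then the first Pochhammer factor is zero.
\<close>
lemma jacobi_type_eigenvalue_strict_mono:
  assumes "\<beta> > -1" "N > 0" "m < n"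
  shows "jacobi_type_eigenvalue \<alpha> \<beta> N m < jacobi_type_eigenvalue \<alpha> \<beta> N n"
proof -
  have C: "C_const \<alpha> \<beta> > 0" unfolding C_const_def
    using assms by (intro mult_pos_pos pochhammer_pos) auto
  have "Lambda_high \<alpha> \<beta> m \<le> Lambda_high \<alpha> \<beta> n"
  proof (cases "m = 0")
    case True
    thus ?thesis using assms unfolding Lambda_high_def
      by (auto simp: pochhammer_0_left intro!: mult_nonneg_nonneg pochhammer_nonneg)
  next
    case False
    thus ?thesis unfolding Lambda_high_def
      using assms pochhammer_real_strict_mono[of "real m" "real n" "\<alpha> + 1"]
        pochhammer_real_strict_mono[of "real m + \<beta>" "real n + \<beta>" "\<alpha> + 1"]
      by (intro mult_mono pochhammer_nonneg) auto
  qed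
  moreover have "Lambda_two (real \<alpha>) \<beta> m < Lambda_two (real \<alpha>) \<beta> n"
    unfolding Lambda_two_def
    by (cases "m = 0") (use assms in \<open>auto intro!: mult_strict_mono mult_pos_pos\<close>)
  ultimately show ?thesis unfolding jacobi_type_eigenvalue_def
    using C assms by (intro add_le_less_mono mult_left_mono mult_strict_left_mono) auto
qed

section \<open>Moments of the weight\<close>

definition jacobi_mean :: "real \<Rightarrow> real \<Rightarrow> real poly \<Rightarrow> real" where
  "jacobi_mean a b p = integral {-1..1} (\<lambda>x. poly p x * jacobi_w a b x)"

text \<open>
  The substitution \<open>t = (1 - x) / 2\<close> turns this into Euler's Beta integral. The identity of
  the integrands holds even at the end points, because \<open>0 powr c = 0\<close> for every \<open>c\<close>.
\<close>
lemma has_integral_jacobi_weight: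
  assumes "a > -1" "b > -1"
  shows "((\<lambda>x. poly (pu ^ i * pv ^ j) x * ((1 - x) powr a * (1 + x) powr b)) has_integral
           2 powr (a + b + 1) * Beta (a + 1 + real i) (b + 1 + real j)) {-1..1}"
proof -
  have pw: "t ^ i * t powr c = t powr (c + real i)" if "t \<ge> 0" for t c :: real and i
  proof (cases "t = 0")
    case True
    thus ?thesis by (cases i) simp_all
  qed (use that in \<open>simp add: powr_add powr_realpow\<close>)
  have "((\<lambda>t. t powr (a + real i) * (1 - t) powr (b + real j)) has_integral
          Beta (a + 1 + real i) (b + 1 + real j)) (cbox 0 1)"
    using has_integral_Beta_real[of "a + 1 + real i" "b + 1 + real j"] assms by (simp add: algebra_simps)
  from has_integral_affinity[OF this, of "-1/2" "1/2"]
  have "((\<lambda>x. ((1 - x) / 2) powr (a + real i) * ((1 + x) / 2) powr (b + real j)) has_integral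
          2 * Beta (a + 1 + real i) (b + 1 + real j)) ((\<lambda>x. -2 * x + 1) ` {0..1})"
    by (simp add: algebra_simps diff_divide_distrib add_divide_distrib)
  moreover have "(\<lambda>x::real. -2 * x + 1) ` {0..1} = {-1..1}"
    using image_affinity_atLeastAtMost[of "-2" "1::real" 0 1] by simp
  ultimately have "((\<lambda>x. ((1 - x) / 2) powr (a + real i) * ((1 + x) / 2) powr (b + real j))
      has_integral 2 * Beta (a + 1 + real i) (b + 1 + real j)) {-1..1}" by simp
  from has_integral_mult_right[OF this, of "2 powr (a + b)"]
  have "((\<lambda>x. 2 powr (a + b) * (((1 - x) / 2) powr (a + real i) * ((1 + x) / 2) powr (b + real j)))
      has_integral 2 powr (a + b + 1) * Beta (a + 1 + real i) (b + 1 + real j)) {-1..1}"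
    by (simp add: powr_add mult_ac)
  thus ?thesis
  proof (rule has_integral_eq[rotated])
    fix x :: real assume x: "x \<in> {-1..1}"
    show "2 powr (a + b) * (((1 - x) / 2) powr (a + real i) * ((1 + x) / 2) powr (b + real j))
      = poly (pu ^ i * pv ^ j) x * ((1 - x) powr a * (1 + x) powr b)"
    proof -
      have "((1 - x) / 2) powr (a + real i) = ((1 - x) / 2) ^ i * ((1 - x) powr a / 2 powr a)"
        "((1 + x) / 2) powr (b + real j) = ((1 + x) / 2) ^ j * ((1 + x) powr b / 2 powr b)"
        using x pw[of "(1 - x) / 2" i a] pw[of "(1 + x) / 2" j b] by (auto simp: powr_divide)
      thus ?thesis by (simp only: poly_mult poly_power poly_pu poly_pv powr_add) simp
    qed
  qed
qed

lemma jacobi_h_eq: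
  assumes "a > -1" "b > -1"
  shows "jacobi_h a b = 2 powr (a + b + 1) * Beta (a + 1) (b + 1)"
  using integral_unique[OF has_integral_jacobi_weight[OF assms, of 0 0]] by (simp add: jacobi_h_def)

lemma Beta_pos: "Beta x y > 0" if "x > 0" "y > (0::real)"
  using that by (simp add: Beta_def Gamma_real_pos)

lemma jacobi_h_pos: "jacobi_h a b > 0" if "a > -1" "b > -1"
  using that by (simp add: jacobi_h_eq Beta_pos)

lemma Beta_shift_ratio:
  assumes "x > 0" "y > (0::real)"
  shows "Beta (x + real i) (y + real j) / Beta x y
           = pochhammer x i * pochhammer y j / pochhammer (x + y) (i + j)"
proof -
  have np: "z \<notin> \<int>\<^sub>\<le>\<^sub>0" if "z > (0::real)" for z using that by (auto elim!: nonpos_Ints_cases)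
  have G: "Gamma z > 0" if "z > (0::real)" for z using that by (rule Gamma_real_pos)
  have P: "pochhammer z n = Gamma (z + real n) / Gamma z" if "z > 0" for z n
    using that by (intro pochhammer_Gamma np)
  have e: "x + real i + (y + real j) = x + y + real (i + j)" by simp
  have "Gamma x > 0" "Gamma y > 0" "Gamma (x + y) > 0" "Gamma (x + y + real (i + j)) > 0"
    using assms by (auto intro!: G)
  moreover have "x + y > 0" using assms by simp
  ultimately show ?thesis
    using assms by (simp only: Beta_def P e) (simp add: field_simps)
qed

text \<open>
  These values determine the integral of every polynomial, so that symmetry and
  orthogonality become identities between Pochhammer symbols and need no integration by
  parts.
\<close>
lemma jacobi_mean_moment:
  assumes "a > -1" "b > -1"
  shows "jacobi_mean a b (pu ^ i * pv ^ j)
           = pochhammer (a + 1) i * pochhammer (b + 1) j / pochhammer (a + b + 2) (i + j)"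
proof -
  have "((\<lambda>x. poly (pu ^ i * pv ^ j) x * jacobi_w a b x) has_integral
          inverse (jacobi_h a b) * (2 powr (a + b + 1) * Beta (a + 1 + real i) (b + 1 + real j))) {-1..1}"
    using has_integral_mult_right[OF has_integral_jacobi_weight[OF assms, of i j], of "inverse (jacobi_h a b)"]
    by (simp add: jacobi_w_def mult_ac)
  hence "jacobi_mean a b (pu ^ i * pv ^ j)
      = inverse (jacobi_h a b) * (2 powr (a + b + 1) * Beta (a + 1 + real i) (b + 1 + real j))"
    unfolding jacobi_mean_def by (rule integral_unique)
  also have "\<dots> = Beta (a + 1 + real i) (b + 1 + real j) / Beta (a + 1) (b + 1)"
    using assms by (simp add: jacobi_h_eq[OF assms] divide_simps)
  also have "\<dots> = pochhammer (a + 1) i * pochhammer (b + 1) j / pochhammer (a + 1 + (b + 1)) (i + j)"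
    using assms by (intro Beta_shift_ratio) auto
  finally show ?thesis by (simp add: add_ac)
qed

lemma pu_power_induct [case_names zero add power]:
  assumes "P 0" "\<And>p q. P p \<Longrightarrow> P q \<Longrightarrow> P (p + q)" "\<And>c i. P (smult c (pu ^ i))"
  shows "P p"
  using poly_induct_linear_powers[of "-1/2" p "degree p" P "1/2"] assms by (simp add: pu_def)

lemma pv_power_induct [case_names zero add power]:
  assumes "P 0" "\<And>p q. P p \<Longrightarrow> P q \<Longrightarrow> P (p + q)" "\<And>c i. P (smult c (pv ^ i))"
  shows "P p"
  using poly_induct_linear_powers[of "1/2" p "degree p" P "1/2"] assms by (simp add: pv_def)

lemma poly_jacobi_w_integrable:
  assumes "a > -1" "b > -1"
  shows "(\<lambda>x. poly p x * jacobi_w a b x) integrable_on {-1..1}"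
proof (induction p rule: pu_power_induct)
  case (add p q)
  thus ?case by (simp add: distrib_right integrable_add)
next
  case (power c i)
  have "(\<lambda>x. (c * inverse (jacobi_h a b)) * (poly (pu ^ i * pv ^ 0) x * ((1 - x) powr a * (1 + x) powr b)))
      integrable_on {-1..1}"
    using has_integral_jacobi_weight[OF assms, of i 0]
    by (intro integrable_on_mult_right) (auto intro: has_integral_integrable)
  thus ?case by (simp add: jacobi_w_def mult_ac)
qed (simp add: integrable_0)

lemma jacobi_mean_add:
  assumes "a > -1" "b > -1"
  shows "jacobi_mean a b (p + q) = jacobi_mean a b p + jacobi_mean a b q"
  unfolding jacobi_mean_def using assms
  by (simp add: distrib_right integral_add poly_jacobi_w_integrable)

lemma jacobi_mean_smult: "jacobi_mean a b (smult c p) = c * jacobi_mean a b p"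
  unfolding jacobi_mean_def by (simp add: mult.assoc)

lemma jacobi_mean_0 [simp]: "jacobi_mean a b 0 = 0"
  by (simp add: jacobi_mean_def)

lemma jacobi_mean_diff:
  assumes "a > -1" "b > -1"
  shows "jacobi_mean a b (p - q) = jacobi_mean a b p - jacobi_mean a b q"
  using jacobi_mean_add[OF assms, of p "smult (-1) q"] jacobi_mean_smult[of a b "-1" q] by simp

lemma jacobi_mean_sum:
  assumes "a > -1" "b > -1"
  shows "jacobi_mean a b (\<Sum>i\<in>A. f i) = (\<Sum>i\<in>A. jacobi_mean a b (f i))"
  by (induction A rule: infinite_finite_induct) (simp_all add: jacobi_mean_add[OF assms])

text \<open>
  The weight may be unbounded or vanish at the end points, so continuity is only used on
  \<open>[-1/2, 1/2]\<close>, where the weight is positive; a polynomial that vanishes there is zero.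
\<close>
lemma jacobi_mean_square_nonpos_imp_0:
  assumes "a > -1" "b > -1" "jacobi_mean a b (p * p) \<le> 0"
  shows "p = 0"
proof -
  let ?f = "\<lambda>x. poly (p * p) x * jacobi_w a b x"
  have nonneg: "?f x \<ge> 0" for x
    using jacobi_h_pos[OF assms(1,2)] by (simp add: jacobi_w_def)
  have int: "?f integrable_on {-1..1}" by (rule poly_jacobi_w_integrable[OF assms(1,2)])
  have int': "?f integrable_on {-1/2..1/2}"
    by (rule integrable_on_subinterval[OF int]) auto
  have "integral {-1/2..1/2} ?f \<le> integral {-1..1} ?f"
    by (rule integral_subset_le) (use int int' nonneg in auto)
  moreover have "integral {-1/2..1/2} ?f \<ge> 0" using nonneg by (intro integral_nonneg int') auto
  ultimately have "(?f has_integral 0) (cbox (-1/2) (1/2))"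
    using int' assms(3) unfolding jacobi_mean_def by (simp add: has_integral_iff)
  moreover have "continuous_on (cbox (-1/2) (1/2)) ?f"
    unfolding jacobi_w_def by (auto intro!: continuous_intros)
  ultimately have "?f x = 0" if "x \<in> cbox (-1/2) (1/2)" for x
    using has_integral_0_cbox_imp_0[of "-1/2" "1/2" ?f x] nonneg that by auto
  hence "poly p x = 0" if "x \<in> {-1/2..1/2}" for x
    using that jacobi_h_pos[OF assms(1,2)] by (auto simp: jacobi_w_def)
  hence "{-1/2..1/2} \<subseteq> {x. poly p x = 0}" by blast
  moreover have "infinite {-1/2..(1/2::real)}" by simp
  ultimately show ?thesis using poly_roots_finite finite_subset by blast
qed

section \<open>The operators on powers of the first variable\<close>

lemma high_op_add: "high_op \<alpha> \<beta> (p + q) = high_op \<alpha> \<beta> p + high_op \<alpha> \<beta> q"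
  unfolding high_op_def by (simp only: distrib_left higher_pderiv_add euler_op_add)

lemma high_op_smult: "high_op \<alpha> \<beta> (smult c p) = smult c (high_op \<alpha> \<beta> p)"
  unfolding high_op_def by (simp only: mult_smult_right higher_pderiv_smult euler_op_smult)

lemma two_op_add: "two_op \<alpha> \<beta> (p + q) = two_op \<alpha> \<beta> p + two_op \<alpha> \<beta> q"
  unfolding two_op_def by (simp only: distrib_left pderiv_add add_ac)

lemma two_op_smult: "two_op \<alpha> \<beta> (smult c p) = smult c (two_op \<alpha> \<beta> p)"
  unfolding two_op_def by (simp only: mult_smult_right pderiv_smult smult_add_right)

lemma jacobi_type_op_add: "jacobi_type_op \<alpha> \<beta> N (p + q) = jacobi_type_op \<alpha> \<beta> N p + jacobi_type_op \<alpha> \<beta> N q"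
  unfolding jacobi_type_op_def by (simp only: high_op_add two_op_add smult_add_right add_ac)

lemma jacobi_type_op_smult: "jacobi_type_op \<alpha> \<beta> N (smult c p) = smult c (jacobi_type_op \<alpha> \<beta> N p)"
  unfolding jacobi_type_op_def by (simp add: high_op_smult two_op_smult smult_add_right mult.commute)

text \<open>
  The inner factor is diagonal on powers of \<open>u\<close> up to a shift of the exponent by one: the
  sign and the powers of two from \<open>x - 1 = - 2 u\<close> and \<open>d/dx = - 1/2 d/du\<close> cancel against the
  outer factor \<open>x - 1\<close>. It kills the constants because \<open>(x - 1)\<close> to the power \<open>\<alpha> + 1\<close>
  is differentiated \<open>\<alpha> + 2\<close> times.
\<close>
lemma high_op_pu_power:
  "high_op \<alpha> \<beta> (pu ^ Suc i)
     = smult (pochhammer (real i + 1) (\<alpha> + 2)) (pu * euler_op \<beta> (\<alpha> + 2) (pu ^ i))"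
  "high_op \<alpha> \<beta> 1 = 0"
proof -
  have X: "[:-1, 1:] = smult (-2) pu" by (simp add: pu_def)
  have D: "(pderiv ^^ j) (pu ^ (i + j)) = smult ((-1/2) ^ j * pochhammer (real i + 1) j) (pu ^ i)" for i j
  proof (induction j)
    case (Suc j)
    have "pderiv (pu ^ (i + Suc j)) = smult (- 1 / 2 * (real i + 1 + real j)) (pu ^ (i + j))"
      by (simp add: pderiv_power_Suc pderiv_pu add_ac del: power_Suc)
    hence "(pderiv ^^ Suc j) (pu ^ (i + Suc j))
        = smult (- 1 / 2 * (real i + 1 + real j) * ((-1/2) ^ j * pochhammer (real i + 1) j)) (pu ^ i)"
      by (simp only: funpow_Suc_right o_apply higher_pderiv_smult Suc smult_smult)
    also have "- 1 / 2 * (real i + 1 + real j) * ((-1/2) ^ j * pochhammer (real i + 1) j)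
        = (-1/2) ^ Suc j * pochhammer (real i + 1) (Suc j)"
      by (simp add: pochhammer_Suc)
    finally show ?case .
  qed simp
  have e: "[:-1, 1:] ^ (\<alpha> + 1) * p = smult ((-2) ^ (\<alpha> + 1)) (pu ^ (\<alpha> + 1) * p)" for p
    by (simp only: X smult_power mult_smult_left)
  have "pu ^ (\<alpha> + 1) * pu ^ Suc i = pu ^ (i + (\<alpha> + 2))"
    by (simp flip: power_add power_Suc add: add_ac)
  hence "(pderiv ^^ (\<alpha> + 2)) ([:-1, 1:] ^ (\<alpha> + 1) * pu ^ Suc i)
      = smult ((-2) ^ (\<alpha> + 1) * ((-1/2) ^ (\<alpha> + 2) * pochhammer (real i + 1) (\<alpha> + 2))) (pu ^ i)"
    by (simp only: e higher_pderiv_smult D smult_smult)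
  also have "(-2::real) ^ (\<alpha> + 1) * ((-1/2) ^ (\<alpha> + 2) * pochhammer (real i + 1) (\<alpha> + 2))
      = -1/2 * pochhammer (real i + 1) (\<alpha> + 2)"
    by (simp add: power_add flip: power_mult_distrib mult.assoc del: pochhammer_Suc)
  finally show "high_op \<alpha> \<beta> (pu ^ Suc i)
     = smult (pochhammer (real i + 1) (\<alpha> + 2)) (pu * euler_op \<beta> (\<alpha> + 2) (pu ^ i))"
    unfolding high_op_def by (simp only: euler_op_smult X) simp
  have "(pderiv ^^ (\<alpha> + 2)) (pu ^ (\<alpha> + 1)) = pderiv ((pderiv ^^ (\<alpha> + 1)) (pu ^ (0 + (\<alpha> + 1))))"
    by simp
  also have "\<dots> = 0" unfolding D by simp
  finally show "high_op \<alpha> \<beta> 1 = 0"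
    unfolding high_op_def e by (simp only: higher_pderiv_smult) simp
qed

text \<open>
  In the variable \<open>u\<close> the operator is \<open>- u (1 - u)\<close> times the second derivative plus
  \<open>(\<alpha> + \<beta> + 2) u - (\<alpha> + 1)\<close> times the first.
\<close>
lemma two_op_pu_power:
  "two_op \<alpha> \<beta> (pu ^ Suc i) =
     smult ((real i + 1) * (real i + \<alpha> + \<beta> + 2)) (pu ^ Suc i) - smult ((real i + 1) * (real i + \<alpha> + 1)) (pu ^ i)"
  "two_op \<alpha> \<beta> 1 = 0"
proof -
  have 1: "[:-1, 0, 1:] = smult (-4) (pu - pu * pu)" "[:\<alpha> - \<beta>, \<alpha> + \<beta> + 2:] = [:2 * \<alpha> + 2:] - smult (2 * (\<alpha> + \<beta> + 2)) pu"
    by (simp_all add: pu_def field_simps)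
  have d: "pderiv (pu ^ Suc i) = smult (- ((1 + real i) / 2)) (pu ^ i)" for i
    by (simp add: pderiv_power_Suc pderiv_pu del: power_Suc)
  have "pu * pderiv (pderiv (pu ^ Suc i)) = smult ((real i + 1) * real i / 4) (pu ^ i)"
  proof (cases i)
    case (Suc m)
    have "pderiv (pderiv (pu ^ Suc i)) = smult (- ((1 + real i) / 2) * - ((1 + real m) / 2)) (pu ^ m)"
      by (simp only: d pderiv_smult Suc smult_smult)
    thus ?thesis by (simp add: Suc add_ac mult_ac)
  qed (use d[of 0] in \<open>simp add: pderiv_pu pderiv_pCons\<close>)
  moreover have f: "(pu - pu * pu) * r = (1 - pu) * (pu * r)" for r
    by (simp add: algebra_simps)
  ultimately have "two_op \<alpha> \<beta> (pu ^ Suc i) = smult (-4) ((1 - pu) * smult ((real i + 1) * real i / 4) (pu ^ i))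
     + ([:2 * \<alpha> + 2:] - smult (2 * (\<alpha> + \<beta> + 2)) pu) * smult (- ((1 + real i) / 2)) (pu ^ i)"
    unfolding two_op_def 1 d[symmetric] by (simp only: mult_smult_left f)
  also have "\<dots> = smult ((real i + 1) * (real i + \<alpha> + \<beta> + 2)) (pu ^ Suc i)
      - smult ((real i + 1) * (real i + \<alpha> + 1)) (pu ^ i)"
    by (rule poly_eq_poly_eq_iff[THEN iffD1]) (simp add: fun_eq_iff field_simps)
  finally show "two_op \<alpha> \<beta> (pu ^ Suc i) = \<dots>" .
qed (simp add: two_op_def)

section \<open>Symmetry of the combined operator\<close>

text \<open>
  This replaces an \<open>\<alpha> + 2\<close>-fold integration by parts without boundary terms. On the
  powers of \<open>v\<close> both sides are explicit moments and agree up to a factor that does not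
  involve the power. The weight exponent of \<open>u\<close> drops to zero on the right, and the
  Pochhammer factor in \<open>l\<close> is the one that \<open>high_op\<close> produces from the other argument of the
  pairing; their product is symmetric.
\<close>
lemma euler_op_pairing:
  assumes "\<beta> > -1"
  shows "jacobi_mean (real \<alpha>) \<beta> (pu ^ (l + 2) * euler_op \<beta> (\<alpha> + 2) q)
       = pochhammer (real l + 1) (\<alpha> + 2) * (pochhammer (\<beta> + 2) \<alpha> / fact \<alpha>)
           * jacobi_mean 0 \<beta> (pu ^ l * pv ^ (\<alpha> + 2) * q)"
proof (induction q rule: pv_power_induct)
  case (add p q)
  thus ?case using assms by (simp only: euler_op_add distrib_left) (simp add: jacobi_mean_add distrib_left)
next
  case (power c j)
  let ?k = "\<alpha> + 2"
  \<comment> \<open>Both products are the factorial of \<open>\<alpha> + l + 2\<close>, split at different places.\<close>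
  have f: "pochhammer (real \<alpha> + 1) (l + 2) * fact \<alpha> = (pochhammer (real l + 1) ?k * fact l :: real)"
    using pochhammer_product'[of "1::real" \<alpha> "l + 2"] pochhammer_product'[of "1::real" l ?k]
    by (simp only: pochhammer_fact[symmetric] add.commute mult.commute) (simp add: add_ac)
  have b: "pochhammer (\<beta> + 1) (?k + j) = pochhammer (\<beta> + 1) j * pochhammer (\<beta> + 1 + real j) ?k"
    using pochhammer_product'[of "\<beta> + 1" j ?k] by (simp only: add.commute)
  have d: "pochhammer (\<beta> + 2) (l + (?k + j)) = pochhammer (\<beta> + 2) \<alpha> * pochhammer (real \<alpha> + \<beta> + 2) (l + 2 + j)"
    using pochhammer_product'[of "\<beta> + 2" \<alpha> "l + 2 + j"] by (simp add: add_ac del: pochhammer_Suc)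
  have nz: "pochhammer (\<beta> + 2) \<alpha> \<noteq> 0" "pochhammer (real \<alpha> + \<beta> + 2) (l + 2 + j) \<noteq> 0"
    using assms pochhammer_pos[of "\<beta> + 2" \<alpha>] pochhammer_pos[of "real \<alpha> + \<beta> + 2" "l + 2 + j"]
    by (linarith, simp add: add_nonneg_pos)
  have "jacobi_mean (real \<alpha>) \<beta> (pu ^ (l + 2) * euler_op \<beta> ?k (smult c (pv ^ j)))
      = c * pochhammer (\<beta> + 1 + real j) ?k * jacobi_mean (real \<alpha>) \<beta> (pu ^ (l + 2) * pv ^ j)"
    by (simp only: euler_op_smult euler_op_pv_power mult_smult_right jacobi_mean_smult mult.assoc)
  also have "\<dots> = c * (pochhammer (real \<alpha> + 1) (l + 2) * pochhammer (\<beta> + 1) (?k + j)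
      / pochhammer (real \<alpha> + \<beta> + 2) (l + 2 + j))"
    unfolding b using assms by (subst jacobi_mean_moment) (simp_all del: pochhammer_Suc)
  also have "\<dots> = c * (pochhammer (real l + 1) ?k * (pochhammer (\<beta> + 2) \<alpha> / fact \<alpha>) *
      (fact l * pochhammer (\<beta> + 1) (?k + j) / pochhammer (\<beta> + 2) (l + (?k + j))))"
    unfolding d using nz f by (simp add: field_simps del: pochhammer_Suc)
  also have "fact l * pochhammer (\<beta> + 1) (?k + j) / pochhammer (\<beta> + 2) (l + (?k + j))
      = jacobi_mean 0 \<beta> (pu ^ l * pv ^ (?k + j))"
    using assms by (subst jacobi_mean_moment) (simp_all add: pochhammer_fact)
  finally have "jacobi_mean (real \<alpha>) \<beta> (pu ^ (l + 2) * euler_op \<beta> ?k (smult c (pv ^ j)))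
      = c * (pochhammer (real l + 1) ?k * (pochhammer (\<beta> + 2) \<alpha> / fact \<alpha>) * jacobi_mean 0 \<beta> (pu ^ l * pv ^ (?k + j)))" .
  moreover have "pu ^ l * pv ^ ?k * smult c (pv ^ j) = smult c (pu ^ l * pv ^ (?k + j))"
    by (simp only: mult_smult_right mult_smult_left power_add mult_ac)
  ultimately show ?case by (simp only: jacobi_mean_smult mult_ac)
qed simp

text \<open>
  The case left out by the preceding lemma: with a single factor \<open>u\<close> only the boundary term
  at \<open>x = 1\<close> of the integration by parts survives. For a power of \<open>v\<close> the pairing does not
  depend on the exponent, and neither does the value at \<open>x = 1\<close>. This term is what spoils
  the symmetry of \<open>high_op\<close> with respect to the weight alone.
\<close>
lemma euler_op_boundary:
  assumes "\<beta> > -1"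
  shows "jacobi_mean (real \<alpha>) \<beta> (pu * euler_op \<beta> (\<alpha> + 2) q)
       = (real \<alpha> + 1) * pochhammer (\<beta> + 1) (\<alpha> + 1) * poly q 1"
proof (induction q rule: pv_power_induct)
  case (add p q)
  thus ?case using assms by (simp only: euler_op_add distrib_left) (simp add: jacobi_mean_add distrib_left)
next
  case (power c j)
  let ?k = "\<alpha> + 2"
  have "pochhammer (\<beta> + 1) j * pochhammer (\<beta> + 1 + real j) ?k = pochhammer (\<beta> + 1) (\<alpha> + 1 + (j + 1))"
    using pochhammer_product'[of "\<beta> + 1" j ?k] by (simp add: add_ac del: pochhammer_Suc)
  also have "\<dots> = pochhammer (\<beta> + 1) (\<alpha> + 1) * pochhammer (real \<alpha> + \<beta> + 2) (1 + j)"
    using pochhammer_product'[of "\<beta> + 1" "\<alpha> + 1" "j + 1"] by (simp add: add_ac del: pochhammer_Suc)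
  finally have b: "pochhammer (\<beta> + 1) j * pochhammer (\<beta> + 1 + real j) ?k = \<dots>" .
  have nz: "pochhammer (real \<alpha> + \<beta> + 2) (1 + j) \<noteq> 0"
    using assms pochhammer_pos[of "real \<alpha> + \<beta> + 2" "1 + j"] by (simp add: add_nonneg_pos)
  have "jacobi_mean (real \<alpha>) \<beta> (pu * euler_op \<beta> ?k (smult c (pv ^ j)))
      = c * pochhammer (\<beta> + 1 + real j) ?k * jacobi_mean (real \<alpha>) \<beta> (pu ^ 1 * pv ^ j)"
    by (simp only: euler_op_smult euler_op_pv_power mult_smult_right jacobi_mean_smult mult.assoc power_one_right)
  also have "\<dots> = c * ((real \<alpha> + 1) * (pochhammer (\<beta> + 1) j * pochhammer (\<beta> + 1 + real j) ?k)
      / pochhammer (real \<alpha> + \<beta> + 2) (1 + j))"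
    using assms by (subst jacobi_mean_moment) (simp_all del: pochhammer_Suc)
  also have "\<dots> = c * (real \<alpha> + 1) * pochhammer (\<beta> + 1) (\<alpha> + 1)"
    unfolding b using nz by (simp del: pochhammer_Suc)
  finally show ?case by (simp add: poly_pv mult_ac)
qed simp

definition jacobi_type_form :: "nat \<Rightarrow> real \<Rightarrow> real \<Rightarrow> real poly \<Rightarrow> real poly \<Rightarrow> real" where
  "jacobi_type_form \<alpha> \<beta> N p q = jacobi_mean (real \<alpha>) \<beta> (p * q) + N * poly p 1 * poly q 1"

lemma jacobi_type_form_commute: "jacobi_type_form \<alpha> \<beta> N p q = jacobi_type_form \<alpha> \<beta> N q p"
  by (simp add: jacobi_type_form_def mult_ac)

lemma jacobi_type_form_add:
  "\<beta> > -1 \<Longrightarrow> jacobi_type_form \<alpha> \<beta> N (p + q) r = jacobi_type_form \<alpha> \<beta> N p r + jacobi_type_form \<alpha> \<beta> N q r"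
  "\<beta> > -1 \<Longrightarrow> jacobi_type_form \<alpha> \<beta> N r (p + q) = jacobi_type_form \<alpha> \<beta> N r p + jacobi_type_form \<alpha> \<beta> N r q"
  by (simp_all add: jacobi_type_form_def jacobi_mean_add algebra_simps)

lemma jacobi_type_form_smult:
  "jacobi_type_form \<alpha> \<beta> N (smult c p) r = c * jacobi_type_form \<alpha> \<beta> N p r"
  "jacobi_type_form \<alpha> \<beta> N r (smult c p) = c * jacobi_type_form \<alpha> \<beta> N r p"
  by (simp_all add: jacobi_type_form_def jacobi_mean_smult algebra_simps)

lemma jacobi_type_form_0 [simp]: "jacobi_type_form \<alpha> \<beta> N 0 r = 0" "jacobi_type_form \<alpha> \<beta> N r 0 = 0"
  by (simp_all add: jacobi_type_form_def)

lemma jacobi_type_op_0 [simp]: "jacobi_type_op \<alpha> \<beta> N 0 = 0"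
  using jacobi_type_op_smult[of \<alpha> \<beta> N 0 0] by simp

text \<open>
  Symmetry of the operator of second order: apart from a factor depending only on the sum of
  the two exponents, the value is their product \<open>(i + 1) l\<close>.
\<close>
lemma two_op_pairing:
  assumes "a > -1" "b > -1"
  shows "jacobi_mean a b (two_op a b (pu ^ Suc i) * pu ^ l)
       = (real i + 1) * real l * (b + 1) / (a + b + 2 + real i + real l) * jacobi_mean a b (pu ^ (i + l))"
proof -
  have m: "jacobi_mean a b (pu ^ n) = pochhammer (a + 1) n / pochhammer (a + b + 2) n" for n
    using jacobi_mean_moment[OF assms, of n 0] by simp
  have nz: "a + b + 2 + (real i + real l) \<noteq> 0" using assms by linarith
  have s: "jacobi_mean a b (pu ^ Suc (i + l))
      = jacobi_mean a b (pu ^ (i + l)) * ((a + 1 + real i + real l) / (a + b + 2 + (real i + real l)))"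
    unfolding m by (simp add: pochhammer_Suc add_ac)
  have "jacobi_mean a b (two_op a b (pu ^ Suc i) * pu ^ l)
      = (real i + 1) * (real i + a + b + 2) * jacobi_mean a b (pu ^ Suc (i + l))
        - (real i + 1) * (real i + a + 1) * jacobi_mean a b (pu ^ (i + l))"
    unfolding two_op_pu_power left_diff_distrib using assms
    by (simp add: jacobi_mean_diff jacobi_mean_smult power_add mult_ac)
  also have "\<dots> = (real i + 1) * jacobi_mean a b (pu ^ (i + l)) *
     ((real i + a + b + 2) * ((a + 1 + real i + real l) / (a + b + 2 + (real i + real l))) - (real i + a + 1))"
    unfolding s by (simp add: algebra_simps)
  also have "(real i + a + b + 2) * ((a + 1 + real i + real l) / (a + b + 2 + (real i + real l))) - (real i + a + 1)
     = real l * (b + 1) / (a + b + 2 + (real i + real l))"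
    using nz by (simp add: divide_simps) (simp add: algebra_simps)
  finally show ?thesis by (simp add: mult_ac add_ac)
qed

text \<open>
  The right hand side is symmetric in \<open>i\<close> and \<open>l\<close>. For \<open>i = 1\<close> and \<open>l = 0\<close> two contributions
  cancel: the boundary term of \<open>high_op\<close>, and the point mass at \<open>x = 1\<close> applied to \<open>two_op\<close>.
  This is the reason for the value of the constant \<open>C_const\<close>.
\<close>
lemma jacobi_type_op_pairing:
  assumes "\<beta> > -1"
  shows "jacobi_type_form \<alpha> \<beta> N (jacobi_type_op \<alpha> \<beta> N (pu ^ i)) (pu ^ l) =
    (if i = 0 \<or> l = 0 then 0 else
       N * pochhammer (real i) (\<alpha> + 2) * pochhammer (real l) (\<alpha> + 2) * (pochhammer (\<beta> + 2) \<alpha> / fact \<alpha>)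
         * jacobi_mean 0 \<beta> (pu ^ (i + l - 2) * pv ^ (\<alpha> + 2))
       + C_const \<alpha> \<beta> * (real i * real l * (\<beta> + 1) / (real \<alpha> + \<beta> + 1 + real i + real l)
         * jacobi_mean (real \<alpha>) \<beta> (pu ^ (i + l - 1))))"
proof (cases i)
  case 0
  thus ?thesis by (simp add: jacobi_type_op_def high_op_pu_power two_op_pu_power)
next
  case (Suc m)
  \<comment> \<open>Here \<open>0 ^ m\<close> is the value at \<open>x = 1\<close> of the \<open>m\<close>-th power of \<open>u\<close>, which is nonzero for \<open>m = 0\<close> only.\<close>
  have one: "poly (jacobi_type_op \<alpha> \<beta> N (pu ^ i)) 1 = - C_const \<alpha> \<beta> * (real \<alpha> + 1) * 0 ^ m"
    unfolding jacobi_type_op_def Suc high_op_pu_power two_op_pu_power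
    by (cases m) (simp_all add: poly_pu algebra_simps del: pochhammer_Suc euler_op.simps)
  have E: "jacobi_mean (real \<alpha>) \<beta> (jacobi_type_op \<alpha> \<beta> N (pu ^ i) * r)
      = N * (pochhammer (real m + 1) (\<alpha> + 2) * jacobi_mean (real \<alpha>) \<beta> (pu * r * euler_op \<beta> (\<alpha> + 2) (pu ^ m)))
       + C_const \<alpha> \<beta> * jacobi_mean (real \<alpha>) \<beta> (two_op (real \<alpha>) \<beta> (pu ^ Suc m) * r)" for r
    using assms unfolding jacobi_type_op_def Suc high_op_pu_power distrib_right
    by (simp add: jacobi_mean_add jacobi_mean_smult mult_ac del: pochhammer_Suc euler_op.simps power_Suc)
  show ?thesis
  proof (cases l)
    case 0
    have "pochhammer (real m + 1) (\<alpha> + 2) * poly (pu ^ m) 1 = fact (\<alpha> + 2) * 0 ^ m"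
      by (cases m) (simp_all add: poly_pu pochhammer_fact del: pochhammer_Suc fact_Suc)
    hence "jacobi_mean (real \<alpha>) \<beta> (jacobi_type_op \<alpha> \<beta> N (pu ^ i))
        = N * (fact (\<alpha> + 2) * 0 ^ m) * ((real \<alpha> + 1) * pochhammer (\<beta> + 1) (\<alpha> + 1))"
      using E[of 1] two_op_pairing[of "real \<alpha>" \<beta> m 0] assms euler_op_boundary[OF assms, of \<alpha> "pu ^ m"]
      by (simp del: pochhammer_Suc euler_op.simps power_Suc fact_Suc)
    thus ?thesis using 0 Suc one
      by (simp add: jacobi_type_form_def C_const_def del: pochhammer_Suc euler_op.simps power_Suc fact_Suc)
  next
    case (Suc n)
    have "pu * pu ^ l = pu ^ (n + 2)" using Suc by simp
    hence "jacobi_type_form \<alpha> \<beta> N (jacobi_type_op \<alpha> \<beta> N (pu ^ i)) (pu ^ l) =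
       N * (pochhammer (real m + 1) (\<alpha> + 2) * jacobi_mean (real \<alpha>) \<beta> (pu ^ (n + 2) * euler_op \<beta> (\<alpha> + 2) (pu ^ m)))
       + C_const \<alpha> \<beta> * jacobi_mean (real \<alpha>) \<beta> (two_op (real \<alpha>) \<beta> (pu ^ Suc m) * pu ^ l)"
      using Suc unfolding jacobi_type_form_def by (simp only: E) (simp add: poly_pu)
    also have "jacobi_mean 0 \<beta> (pu ^ n * pv ^ (\<alpha> + 2) * pu ^ m) = jacobi_mean 0 \<beta> (pu ^ (i + l - 2) * pv ^ (\<alpha> + 2))"
      using Suc \<open>i = Suc m\<close> by (simp add: power_add mult_ac)
    ultimately show ?thesis
      using Suc \<open>i = Suc m\<close> two_op_pairing[of "real \<alpha>" \<beta> m l] assms euler_op_pairing[OF assms, of \<alpha> n "pu ^ m"]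
      by (simp add: mult_ac add_ac del: pochhammer_Suc euler_op.simps power_Suc fact_Suc)
  qed
qed

lemma jacobi_type_op_symmetric:
  assumes "\<beta> > -1"
  shows "jacobi_type_form \<alpha> \<beta> N (jacobi_type_op \<alpha> \<beta> N p) q = jacobi_type_form \<alpha> \<beta> N p (jacobi_type_op \<alpha> \<beta> N q)"
proof (induction p rule: pu_power_induct)
  case (power c i)
  show ?case
  proof (induction q rule: pu_power_induct)
    case (power d l)
    have "jacobi_type_form \<alpha> \<beta> N (jacobi_type_op \<alpha> \<beta> N (pu ^ i)) (pu ^ l) = jacobi_type_form \<alpha> \<beta> N (jacobi_type_op \<alpha> \<beta> N (pu ^ l)) (pu ^ i)"
      unfolding jacobi_type_op_pairing[OF assms] by (simp add: add_ac mult_ac)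
    thus ?case by (simp add: jacobi_type_op_smult jacobi_type_form_smult jacobi_type_form_commute[of _ _ _ "pu ^ i"])
  qed (simp_all add: jacobi_type_op_add jacobi_type_form_add assms)
qed (simp_all add: jacobi_type_op_add jacobi_type_form_add assms)

section \<open>Orthogonality of the Jacobi-type polynomials\<close>

lemma gauss_2F1_minus_nat:
  "gauss_2F1 (- real n) b c z =
     (\<Sum>j\<le>n. pochhammer (- real n) j * pochhammer b j / (pochhammer c j * fact j) * z ^ j)"
proof -
  have "pochhammer (- real n) j = 0" if "j > n" for j
    using that by (simp add: pochhammer_of_nat_eq_0_iff)
  thus ?thesis unfolding gauss_2F1_def eval_fps_def
    by (subst suminf_finite[of "{..n}"]) auto
qed

definition jacobi_poly :: "real \<Rightarrow> real \<Rightarrow> nat \<Rightarrow> real poly" where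
  "jacobi_poly a b n = smult (pochhammer (a + 1) n / fact n)
     (\<Sum>j\<le>n. smult (pochhammer (- real n) j * pochhammer (real n + a + b + 1) j
                      / (pochhammer (a + 1) j * fact j)) (pu ^ j))"

definition jacobi_type_poly :: "nat \<Rightarrow> real \<Rightarrow> real \<Rightarrow> nat \<Rightarrow> real poly" where
  "jacobi_type_poly \<alpha> \<beta> N n = jacobi_poly (real \<alpha>) \<beta> n +
     (if n = 0 then 0 else
       smult (- 2 * N * jacobi_A (real \<alpha>) \<beta> n) (pu * jacobi_poly (real \<alpha> + 2) \<beta> (n - 1)))"

lemma poly_jacobi_poly: "poly (jacobi_poly a b n) = jacobi_P a b n"
  by (simp add: fun_eq_iff jacobi_poly_def jacobi_P_def gauss_2F1_minus_nat poly_sum poly_pu)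

lemma poly_jacobi_type_poly: "poly (jacobi_type_poly \<alpha> \<beta> N n) = jacobi_type (real \<alpha>) \<beta> N n"
  by (simp add: fun_eq_iff jacobi_type_poly_def jacobi_type_def jacobi_R_def poly_jacobi_poly poly_pu
        field_simps)

lemma degree_pu_power: "degree (pu ^ j) = j"
  by (simp add: degree_power_eq pu_def)

lemma degree_jacobi_poly: "degree (jacobi_poly a b n) \<le> n"
  unfolding jacobi_poly_def
  by (intro order.trans[OF degree_smult_le] degree_sum_le) (simp_all add: degree_pu_power)

lemma degree_jacobi_type_poly: "degree (jacobi_type_poly \<alpha> \<beta> N n) \<le> n"
proof -
  have "degree (pu * jacobi_poly (real \<alpha> + 2) \<beta> (n - 1)) \<le> n" if "n \<noteq> 0"
    using degree_mult_le[of pu "jacobi_poly (real \<alpha> + 2) \<beta> (n - 1)"] degree_pu_power[of 1]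
      degree_jacobi_poly[of "real \<alpha> + 2" \<beta> "n - 1"] that by simp
  thus ?thesis unfolding jacobi_type_poly_def
    by (intro degree_add_le degree_jacobi_poly) (auto intro: order.trans[OF degree_smult_le] simp del: smult_minus_left)
qed

lemma jacobi_poly_at_1: "poly (jacobi_poly a b n) 1 = pochhammer (a + 1) n / fact n"
proof -
  have "(\<Sum>j\<le>n. f j * 0 ^ j) = (f 0 :: real)" for f
    by (subst sum.remove[of _ 0]) auto
  thus ?thesis by (simp add: jacobi_poly_def poly_sum poly_pu)
qed

lemma jacobi_type_poly_at_1:
  "poly (jacobi_type_poly \<alpha> \<beta> N n) 1 = pochhammer (real \<alpha> + 1) n / fact n"
  by (simp add: jacobi_type_poly_def jacobi_poly_at_1 poly_pu)

text \<open>
  Paired with a power of \<open>v\<close>, the hypergeometric sum loses the denominator parameter \<open>a + 1\<close>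
  to the moments and is summed by the Chu--Vandermonde identity. The result contains
  \<open>pochhammer (i + 1 - n) n\<close>, one of whose factors is zero for \<open>i < n\<close>.
\<close>
lemma jacobi_poly_orthogonal:
  assumes "a > -1" "b > -1" "i < n"
  shows "jacobi_mean a b (jacobi_poly a b n * pv ^ i) = 0"
proof -
  let ?t = "\<lambda>j. pochhammer (real n + a + b + 1) j * pochhammer (- real n) j
              / (fact j * pochhammer (a + b + 2 + real i) j)"
  have "jacobi_mean a b (jacobi_poly a b n * pv ^ i) = pochhammer (a + 1) n / fact n *
     (\<Sum>j\<le>n. pochhammer (- real n) j * pochhammer (real n + a + b + 1) j
                / (pochhammer (a + 1) j * fact j) * jacobi_mean a b (pu ^ j * pv ^ i))"
    using assms by (simp add: jacobi_poly_def jacobi_mean_smult jacobi_mean_sum sum_distrib_right)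
  also have "\<dots> = pochhammer (a + 1) n / fact n *
     (\<Sum>j\<le>n. pochhammer (b + 1) i / pochhammer (a + b + 2) i * ?t j)"
  proof (intro arg_cong[where f = "\<lambda>s. _ * s"] sum.cong refl)
    fix j
    have "pochhammer (a + 1) j > 0" using assms by (intro pochhammer_pos) auto
    moreover have "pochhammer (a + b + 2) (j + i) = pochhammer (a + b + 2) i * pochhammer (a + b + 2 + real i) j"
      using pochhammer_product'[of "a + b + 2" i j] by (simp add: add.commute)
    ultimately show "pochhammer (- real n) j * pochhammer (real n + a + b + 1) j
                / (pochhammer (a + 1) j * fact j) * jacobi_mean a b (pu ^ j * pv ^ i)
        = pochhammer (b + 1) i / pochhammer (a + b + 2) i * ?t j"
      unfolding jacobi_mean_moment[OF assms(1,2)] by (simp add: mult_ac)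
  qed
  also have "\<dots> = pochhammer (a + 1) n / fact n * (pochhammer (b + 1) i / pochhammer (a + b + 2) i) * sum ?t {0..n}"
    by (simp only: sum_distrib_left[symmetric] mult.assoc atLeast0AtMost)
  also have "sum ?t {0..n} = pochhammer (a + b + 2 + real i - (real n + a + b + 1)) n / pochhammer (a + b + 2 + real i) n"
    using Vandermonde_pochhammer[of n "a + b + 2 + real i" "real n + a + b + 1"] assms by simp
  also have "a + b + 2 + real i - (real n + a + b + 1) = - real (n - 1 - i)"
    using assms by simp
  also have "pochhammer (- real (n - 1 - i)) n = 0"
    using assms unfolding pochhammer_of_nat_eq_0_iff by linarith
  finally show ?thesis by simp
qed

text \<open>
  Two factors \<open>u\<close> may be moved into the weight. This makes the orthogonality of the Jacobi
  polynomials with parameter \<open>\<alpha> + 2\<close> available for the weight with parameter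
  \<open>\<alpha>\<close>.
\<close>
lemma jacobi_mean_shift:
  assumes "a > -1" "b > -1"
  shows "jacobi_mean a b (pu ^ 2 * p) = pochhammer (a + 1) 2 / pochhammer (a + b + 2) 2 * jacobi_mean (a + 2) b p"
proof (induction p rule: pu_power_induct)
  case (add p q)
  thus ?case using assms by (simp add: distrib_left jacobi_mean_add)
next
  case (power c i)
  have a2: "a + 2 > -1" using assms by simp
  have "jacobi_mean a b (pu ^ 2 * smult c (pu ^ i)) = c * jacobi_mean a b (pu ^ (2 + i) * pv ^ 0)"
    by (simp only: mult_smult_right jacobi_mean_smult power_add power_0 mult_1_right)
  also have "jacobi_mean a b (pu ^ (2 + i) * pv ^ 0) =
      pochhammer (a + 1) 2 / pochhammer (a + b + 2) 2 * jacobi_mean (a + 2) b (pu ^ i * pv ^ 0)"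
    unfolding jacobi_mean_moment[OF assms] jacobi_mean_moment[OF a2 assms(2)]
    using pochhammer_product'[of "a + 1" 2 i] pochhammer_product'[of "a + b + 2" 2 i]
    by (simp add: add_ac)
  finally show ?case by (simp add: jacobi_mean_smult mult_ac)
qed simp

text \<open>
  With only one factor \<open>u\<close> the Jacobi polynomial belongs to the wrong weight and the pairing
  with a general power of \<open>v\<close> is a terminating \<open>3F2\<close>. For the exponent \<open>m\<close>, a numerator and
  a denominator parameter coincide, and the Chu--Vandermonde identity applies again.
\<close>
lemma jacobi_poly_boundary_pairing:
  assumes "a > -1" "b > -1"
  shows "jacobi_mean a b (pu * jacobi_poly (a + 2) b m * pv ^ m)
       = (a + 1) * pochhammer (b + 1) m / pochhammer (a + b + 2) (Suc m)"
proof -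
  let ?t = "\<lambda>j. pochhammer (a + 2) j * pochhammer (- real m) j / (fact j * pochhammer (a + 3) j)"
  have "pu * jacobi_poly (a + 2) b m * pv ^ m = smult (pochhammer (a + 3) m / fact m)
     (\<Sum>j\<le>m. smult (pochhammer (- real m) j * pochhammer (real m + a + b + 3) j
                / (pochhammer (a + 3) j * fact j)) (pu ^ Suc j * pv ^ m))"
    by (simp add: jacobi_poly_def sum_distrib_left sum_distrib_right mult_ac add_ac)
  hence "jacobi_mean a b (pu * jacobi_poly (a + 2) b m * pv ^ m) = pochhammer (a + 3) m / fact m *
     (\<Sum>j\<le>m. pochhammer (- real m) j * pochhammer (real m + a + b + 3) j
                / (pochhammer (a + 3) j * fact j) * jacobi_mean a b (pu ^ Suc j * pv ^ m))"
    using assms by (simp only: jacobi_mean_smult jacobi_mean_sum)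
  also have "\<dots> = pochhammer (a + 3) m / fact m *
     (\<Sum>j\<le>m. (a + 1) * pochhammer (b + 1) m / pochhammer (a + b + 2) (Suc m) * ?t j)"
  proof (intro arg_cong[where f = "\<lambda>s. _ * s"] sum.cong refl)
    fix j
    have "pochhammer (real m + a + b + 3) j > 0" using assms by (intro pochhammer_pos) auto
    moreover have "pochhammer (a + b + 2) (Suc j + m)
        = pochhammer (a + b + 2) (Suc m) * pochhammer (real m + a + b + 3) j"
      using pochhammer_product'[of "a + b + 2" "Suc m" j] by (simp add: add_ac del: pochhammer_Suc)
    moreover have "pochhammer (a + 1) (Suc j) = (a + 1) * pochhammer (a + 2) j"
      by (simp add: pochhammer_rec add_ac)
    ultimately show "pochhammer (- real m) j * pochhammer (real m + a + b + 3) j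
                / (pochhammer (a + 3) j * fact j) * jacobi_mean a b (pu ^ Suc j * pv ^ m)
        = (a + 1) * pochhammer (b + 1) m / pochhammer (a + b + 2) (Suc m) * ?t j"
      unfolding jacobi_mean_moment[OF assms] by (simp add: mult_ac del: pochhammer_Suc)
  qed
  also have "\<dots> = pochhammer (a + 3) m / fact m *
      ((a + 1) * pochhammer (b + 1) m / pochhammer (a + b + 2) (Suc m)) * sum ?t {0..m}"
    by (simp only: sum_distrib_left[symmetric] mult.assoc atLeast0AtMost)
  also have "sum ?t {0..m} = pochhammer (a + 3 - (a + 2)) m / pochhammer (a + 3) m"
    using Vandermonde_pochhammer[of m "a + 3" "a + 2"] assms by simp
  also have "\<dots> = fact m / pochhammer (a + 3) m" by (simp add: pochhammer_fact)
  finally show ?thesis using assms pochhammer_pos[of "a + 3" m] by simp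
qed

text \<open>
  Two kinds of test polynomials suffice. Against \<open>u\<close> times the \<open>i\<close>-th power of \<open>v\<close>, with
  \<open>i < n - 1\<close>, the point mass vanishes and both summands of the polynomial are orthogonal.
  Against the power of \<open>v\<close> with exponent \<open>n - 1\<close>, the first summand is still orthogonal, and
  the constant \<open>jacobi_A\<close> is such that the second one compensates the point mass. Since
  \<open>u + v = 1\<close>, each lower power of \<open>v\<close> is the next power plus a test polynomial of the first
  kind.
\<close>
lemma jacobi_type_poly_orthogonal:
  assumes "\<beta> > -1" "degree q < n"
  shows "jacobi_type_form \<alpha> \<beta> N (jacobi_type_poly \<alpha> \<beta> N n) q = 0"
proof -
  let ?a = "real \<alpha>" and ?y = "jacobi_type_poly \<alpha> \<beta> N n"
  obtain m where n: "n = Suc m" using assms(2) by (cases n) auto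
  have a: "?a > -1" "?a + 2 > -1" by simp_all
  define Q where "Q = jacobi_poly (?a + 2) \<beta> m"
  define P where "P = jacobi_poly ?a \<beta> n"
  define A where "A = jacobi_A ?a \<beta> n"
  have y: "?y = P + smult (- 2 * N * A) (pu * Q)"
    by (simp add: jacobi_type_poly_def n Q_def P_def A_def)
  have P: "jacobi_mean ?a \<beta> (P * pv ^ i) = 0" if "i < n" for i
    unfolding P_def using a assms that by (intro jacobi_poly_orthogonal)
  have Q: "jacobi_mean (?a + 2) \<beta> (Q * pv ^ i) = 0" if "i < m" for i
    unfolding Q_def using a assms that by (intro jacobi_poly_orthogonal)
  have mixed: "jacobi_type_form \<alpha> \<beta> N ?y (pu * pv ^ i) = 0" if "i < m" for i
  proof -
    have "P * (pu * pv ^ i) = P * pv ^ i - P * pv ^ Suc i"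
      using pu_add_pv by (simp add: algebra_simps flip: distrib_left distrib_right)
    hence "jacobi_mean ?a \<beta> (P * (pu * pv ^ i)) = 0"
      using P[of i] P[of "Suc i"] that n a assms by (simp add: jacobi_mean_diff del: power_Suc)
    moreover have "pu * Q * (pu * pv ^ i) = pu ^ 2 * (Q * pv ^ i)"
      by (simp add: power2_eq_square mult_ac)
    hence "jacobi_mean ?a \<beta> (pu * Q * (pu * pv ^ i)) = 0"
      using jacobi_mean_shift[OF a(1) assms(1), of "Q * pv ^ i"] Q[OF that] by (simp only: mult_zero_right)
    ultimately show ?thesis
      unfolding jacobi_type_form_def y distrib_right mult_smult_left
        jacobi_mean_add[OF a(1) assms(1)] jacobi_mean_smult by (simp add: poly_pu)
  qed
  have top: "jacobi_type_form \<alpha> \<beta> N ?y (pv ^ m) = 0"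
  proof -
    have pos: "pochhammer (\<beta> + 1) m > 0" "pochhammer (?a + \<beta> + 2) n > 0"
      using assms by (auto intro!: pochhammer_pos)
    have "jacobi_mean ?a \<beta> (?y * pv ^ m)
        = - 2 * N * A * ((?a + 1) * pochhammer (\<beta> + 1) m / pochhammer (?a + \<beta> + 2) n)"
      unfolding y distrib_right mult_smult_left jacobi_mean_add[OF a(1) assms(1)] jacobi_mean_smult
      using P[of m] jacobi_poly_boundary_pairing[OF a(1) assms(1), of m] n by (simp add: Q_def algebra_simps del: pochhammer_Suc)
    also have "\<dots> = - N * ((?a + 1) * pochhammer (?a + 2) m / fact n)"
      using pos unfolding A_def jacobi_A_def n by (simp add: field_simps del: pochhammer_Suc fact_Suc)
    also have "(?a + 1) * pochhammer (?a + 2) m = pochhammer (?a + 1) n"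
      by (simp add: n pochhammer_rec add_ac)
    finally show ?thesis
      by (simp add: jacobi_type_form_def jacobi_type_poly_at_1 poly_pv)
  qed
  have pow: "jacobi_type_form \<alpha> \<beta> N ?y (pv ^ i) = 0" if "i \<le> m" for i
    using that
  proof (induction rule: inc_induct)
    case (step i)
    have "pv ^ i = pv ^ Suc i + pu * pv ^ i"
      using pu_add_pv by (simp add: add.commute flip: distrib_right)
    hence "jacobi_type_form \<alpha> \<beta> N ?y (pv ^ i) = jacobi_type_form \<alpha> \<beta> N ?y (pv ^ Suc i + pu * pv ^ i)"
      by (rule arg_cong)
    also have "\<dots> = 0"
      using step.IH mixed[OF step.hyps(2)] by (simp only: jacobi_type_form_add(2)[OF assms(1)])
    finally show ?case .
  qed (rule top)
  have "degree q \<le> m" using assms n by simp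
  show ?thesis
  proof (rule poly_induct_linear_powers[where P = "\<lambda>q. jacobi_type_form \<alpha> \<beta> N ?y q = 0" and b = "1/2" and a = "1/2"])
    show "degree q \<le> m" by fact
    show "jacobi_type_form \<alpha> \<beta> N ?y (smult c ([:1/2, 1/2:] ^ i)) = 0" if "i \<le> m" for c i
      using pow[OF that] by (simp add: jacobi_type_form_smult pv_def)
  qed (simp_all add: jacobi_type_form_add[OF assms(1)])
qed

section \<open>Eigenpolynomials\<close>

lemma jacobi_type_op_diff: "jacobi_type_op \<alpha> \<beta> N (p - q) = jacobi_type_op \<alpha> \<beta> N p - jacobi_type_op \<alpha> \<beta> N q"
  using jacobi_type_op_add[of \<alpha> \<beta> N p "smult (-1) q"] jacobi_type_op_smult[of \<alpha> \<beta> N "-1" q] by simp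

text \<open>
  The residual \<open>d\<close> of the eigenvalue equation has degree less than \<open>n\<close>, as the leading terms
  cancel. By symmetry and orthogonality it is orthogonal to all polynomials of degree less
  than \<open>n\<close>, hence to itself, and the form is positive definite.
\<close>
lemma jacobi_type_poly_eigen:
  assumes "\<beta> > -1" "N > 0"
  shows "jacobi_type_op \<alpha> \<beta> N (jacobi_type_poly \<alpha> \<beta> N n)
       = smult (jacobi_type_eigenvalue \<alpha> \<beta> N n) (jacobi_type_poly \<alpha> \<beta> N n)"
proof -
  let ?y = "jacobi_type_poly \<alpha> \<beta> N n"
  define d where "d = jacobi_type_op \<alpha> \<beta> N ?y - smult (jacobi_type_eigenvalue \<alpha> \<beta> N n) ?y"
  have "degree d \<le> n" "coeff d n = 0"
    using jacobi_type_op_leading[OF degree_jacobi_type_poly, of \<alpha> \<beta> N \<alpha> \<beta> N n] degree_jacobi_type_poly[of \<alpha> \<beta> N n]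
    by (auto simp: d_def intro!: degree_diff_le order.trans[OF degree_smult_le])
  have "d = 0"
  proof (rule ccontr)
    assume "d \<noteq> 0"
    hence lt: "degree d < n"
      using \<open>degree d \<le> n\<close> \<open>coeff d n = 0\<close> by (metis leading_coeff_0_iff le_neq_implies_less)
    have "jacobi_type_form \<alpha> \<beta> N (jacobi_type_op \<alpha> \<beta> N ?y) d = jacobi_type_form \<alpha> \<beta> N ?y (jacobi_type_op \<alpha> \<beta> N d)"
      by (rule jacobi_type_op_symmetric[OF assms(1)])
    also have "\<dots> = 0"
      using jacobi_type_op_leading[OF order_refl, of \<alpha> \<beta> N d] lt
      by (intro jacobi_type_poly_orthogonal[OF assms(1)]) auto
    finally have "jacobi_type_form \<alpha> \<beta> N (jacobi_type_op \<alpha> \<beta> N ?y) d = 0" .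
    moreover have "jacobi_type_op \<alpha> \<beta> N ?y = d + smult (jacobi_type_eigenvalue \<alpha> \<beta> N n) ?y" by (simp add: d_def)
    ultimately have "jacobi_type_form \<alpha> \<beta> N d d = 0"
      using jacobi_type_poly_orthogonal[OF assms(1) lt] by (simp add: jacobi_type_form_add[OF assms(1)] jacobi_type_form_smult)
    moreover have "N * poly d 1 * poly d 1 \<ge> 0" using assms by (simp add: mult.assoc)
    ultimately have "jacobi_mean (real \<alpha>) \<beta> (d * d) \<le> 0" unfolding jacobi_type_form_def by linarith
    with \<open>d \<noteq> 0\<close> assms show False using jacobi_mean_square_nonpos_imp_0[of "real \<alpha>" \<beta> d] by simp
  qed
  thus ?thesis by (simp add: d_def)
qed

text \<open>
  Comparing leading coefficients forces the eigenvalue to be the one that belongs to the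
  degree.
\<close>
lemma jacobi_type_op_eigen_degree:
  assumes "\<beta> > -1" "N > 0" "jacobi_type_op \<alpha> \<beta> N p = smult (jacobi_type_eigenvalue \<alpha> \<beta> N n) p" "p \<noteq> 0"
  shows "degree p = n"
proof -
  have "jacobi_type_eigenvalue \<alpha> \<beta> N (degree p) * lead_coeff p = jacobi_type_eigenvalue \<alpha> \<beta> N n * lead_coeff p"
    using jacobi_type_op_leading[OF order_refl, of \<alpha> \<beta> N p] unfolding assms(3) coeff_smult by metis
  hence "jacobi_type_eigenvalue \<alpha> \<beta> N (degree p) = jacobi_type_eigenvalue \<alpha> \<beta> N n" using assms(4) by simp
  thus ?thesis
    using jacobi_type_eigenvalue_strict_mono[OF assms(1,2), of "degree p" n \<alpha>]
      jacobi_type_eigenvalue_strict_mono[OF assms(1,2), of n "degree p" \<alpha>]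
    by (cases "degree p" n rule: linorder_cases) auto
qed

text \<open>
  A combination of the two solutions whose coefficient of \<open>x\<close> to the \<open>n\<close> is zero cannot have
  degree \<open>n\<close>, so it vanishes.
\<close>
lemma jacobi_type_op_eigen_unique:
  assumes "\<beta> > -1" "N > 0" "q \<noteq> 0"
    and p: "jacobi_type_op \<alpha> \<beta> N p = smult (jacobi_type_eigenvalue \<alpha> \<beta> N n) p"
    and q: "jacobi_type_op \<alpha> \<beta> N q = smult (jacobi_type_eigenvalue \<alpha> \<beta> N n) q"
  shows "\<exists>c. p = smult c q"
proof -
  define c where "c = coeff p n / lead_coeff q"
  define d where "d = p - smult c q"
  have dq: "degree q = n" using jacobi_type_op_eigen_degree assms by blast
  have "jacobi_type_op \<alpha> \<beta> N d = smult (jacobi_type_eigenvalue \<alpha> \<beta> N n) d"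
    by (simp add: d_def jacobi_type_op_diff jacobi_type_op_smult p q smult_diff_right mult.commute)
  moreover have "coeff d n = 0" using dq assms(3) by (auto simp: d_def c_def)
  ultimately have "d = 0" using jacobi_type_op_eigen_degree[OF assms(1,2)] by (metis leading_coeff_0_iff)
  thus ?thesis by (auto simp: d_def)
qed

theorem corollary3p3:
  fixes \<alpha> :: nat and \<beta> N :: real and y :: "nat \<Rightarrow> real \<Rightarrow> real"
  assumes "\<beta> > -1" and "N > 0"
  defines "y \<equiv> jacobi_type (real \<alpha>) \<beta> N"
  shows "(\<forall>n. (\<exists>p :: real poly. y n = poly p) \<and> y n \<noteq> (\<lambda>x. 0)
            \<and> solves_jacobi_type_eq \<alpha> \<beta> N n (y n)
            \<and> (\<forall>p :: real poly. solves_jacobi_type_eq \<alpha> \<beta> N n (poly p)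
                 \<longrightarrow> (\<exists>c. \<forall>x. poly p x = c * y n x)))
       \<and> (\<forall>n m. n \<noteq> m \<longrightarrow> jacobi_type_inner (real \<alpha>) \<beta> N (y n) (y m) = 0)"
proof -
  define Y where "Y = jacobi_type_poly \<alpha> \<beta> N"
  have y: "y n = poly (Y n)" for n by (simp add: y_def Y_def poly_jacobi_type_poly)
  have "pochhammer (real \<alpha> + 1) n > 0" for n by (intro pochhammer_pos) simp
  hence y1: "y n 1 \<noteq> 0" for n
    by (simp add: y Y_def jacobi_type_poly_at_1 order_less_imp_not_eq2)
  hence Y0: "Y n \<noteq> 0" for n by (metis poly_0 y)
  have eig: "jacobi_type_op \<alpha> \<beta> N (Y n) = smult (jacobi_type_eigenvalue \<alpha> \<beta> N n) (Y n)" for n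
    unfolding Y_def by (rule jacobi_type_poly_eigen[OF assms(1,2)])
  have lt: "jacobi_type_form \<alpha> \<beta> N (Y n) (Y m) = 0" if "m < n" for n m
    unfolding Y_def using that degree_jacobi_type_poly[of \<alpha> \<beta> N m]
    by (intro jacobi_type_poly_orthogonal[OF assms(1)]) simp
  have inner: "jacobi_type_inner (real \<alpha>) \<beta> N (y n) (y m) = jacobi_type_form \<alpha> \<beta> N (Y n) (Y m)" for n m
    by (simp add: jacobi_type_inner_def jacobi_type_form_def jacobi_mean_def y)
  have "jacobi_type_inner (real \<alpha>) \<beta> N (y n) (y m) = 0" if "n \<noteq> m" for n m
    using that lt[of n m] lt[of m n] jacobi_type_form_commute[of \<alpha> \<beta> N "Y n" "Y m"] unfolding inner by linarith
  moreover have "\<exists>c. \<forall>x. poly p x = c * y n x" if "solves_jacobi_type_eq \<alpha> \<beta> N n (poly p)" for n p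
    using jacobi_type_op_eigen_unique[OF assms(1,2) Y0 _ eig, of p n] that
    by (auto simp: solves_jacobi_type_eq_iff y)
  moreover have "solves_jacobi_type_eq \<alpha> \<beta> N n (y n)" for n
    by (simp add: y solves_jacobi_type_eq_iff eig)
  moreover have "y n \<noteq> (\<lambda>x. 0)" for n using y1[of n] by (metis)
  moreover have "\<exists>p. y n = poly p" for n using y by blast
  ultimately show ?thesis by blast
qed

end
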